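(* For all sufficiently large $C$, the equation of state $$\bar e(\tau,S)=\frac{e^{S}}{\tau}+C^2e^{S/C^2-\tau/C},\qquad \tau>0,\ S\in\mathbb R,$$ satisfies, for all $\tau>0$, $S\in\mathbb R$: $\bar e>0$; $-\bar e_\tau>0$; $\bar e_S>0$; $-\bar e_{\tau\tau}<0$; $-\bar e_{\tau\tau\tau}>0$; $-\bar e_{\tau S}>0$; and, for each $\tau>0$, $$\lim_{S\to-\infty}\bar e(\tau,S)=0,\quad \lim_{S\to+\infty}\bar e(\tau,S)=\infty,\quad \lim_{S\to-\infty}-\bar e_\tau(\tau,S)=0,\quad \lim_{S\to+\infty}-\bar e_\tau(\tau,S)=\infty .$$ Moreover it violates the condition $$-\frac{\bar e_{\tau S}}{\bar e_S\,\bar e_{\tau\tau}}<-\frac{2}{\bar e_\tau},$$ i.e., this inequality fails at some $(\tau,S)$.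
   Context: Here $e^{S}$ and $e^{S/C^2-\tau/C}$ denote natural exponentials; subscripts denote partial derivatives. *)

theory Defs imports "HOL-Analysis.Analysis"
begin

text \<open>Partial derivatives of a function of (\<open>\<tau>\<close>, \<open>S\<close>). For the mixed derivative, the
  subscript \<open>\<tau>S\<close> means first \<open>\<tau>\<close>, then \<open>S\<close>.\<close>

definition D_tau :: "(real \<Rightarrow> real \<Rightarrow> real) \<Rightarrow> real \<Rightarrow> real \<Rightarrow> real" where
  "D_tau f \<tau> S = deriv (\<lambda>t. f t S) \<tau>"

definition D_S :: "(real \<Rightarrow> real \<Rightarrow> real) \<Rightarrow> real \<Rightarrow> real \<Rightarrow> real" where
  "D_S f \<tau> S = deriv (\<lambda>s. f \<tau> s) S"

text \<open>Only meaningful for \<open>\<tau> > 0\<close>. This half-plane is open, so the two-sided derivatives there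
  do not see the values at \<open>\<tau> \<le> 0\<close>.\<close>

definition ebar :: "real \<Rightarrow> real \<Rightarrow> real \<Rightarrow> real" where
  "ebar C \<tau> S = exp S / \<tau> + C\<^sup>2 * exp (S / C\<^sup>2 - \<tau> / C)"

end

theory Submission imports Defs
begin

text \<open>
  Write \<open>a = exp S\<close> and \<open>E = exp (S / C\<^sup>2 - \<tau> / C)\<close>. Each derivative in question is, up to sign, a
  combination of \<open>a\<close> and \<open>E\<close> whose coefficients are positive functions of \<open>\<tau>\<close>: each differentiation
  in \<open>\<tau>\<close> flips both signs, and each one in \<open>S\<close> preserves them. This gives all the sign conditions
  for every \<open>C > 0\<close>. The limits follow because, for fixed \<open>\<tau>\<close>, both exponentials increase with \<open>S\<close>
  from \<open>0\<close> to \<open>\<infinity>\<close> (\<open>tendsto_0_exp_combination\<close>, \<open>filterlim_at_top_exp_combination\<close>).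

  After clearing the positive denominators, the last inequality reads
  \<open>(a / \<tau>\<^sup>2 + E / C) * (a / \<tau>\<^sup>2 + C * E) < 2 * (a / \<tau> + E) * (2 * a / \<tau>^3 + E)\<close>.
  The left side contains the cross term \<open>C a E / \<tau>\<^sup>2\<close>, while no coefficient on the right
  depends on \<open>C\<close>. At a fixed \<open>\<tau>\<close> the inequality therefore fails for large \<open>C\<close> wherever
  \<open>a\<close> and \<open>E\<close> are comparable. At \<open>\<tau> = 1\<close> they coincide for \<open>S = - C / (C\<^sup>2 - 1)\<close>, and there the inequality becomes
  \<open>2 + C + 1 / C < 12\<close>, which is false for \<open>C \<ge> 10\<close>.
\<close>

text \<open>Since \<open>D_tau\<close> is a two-sided derivative at a point of an open half-line, a formula for \<open>f\<close>
  valid only for positive \<open>\<tau>\<close> suffices. This is what allows the derivatives of \<open>ebar\<close> to be iterated.\<close>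

lemma D_tau_eqI:
  assumes "\<tau> > 0" and "\<And>t. t > 0 \<Longrightarrow> f t S = g t" and "(g has_real_derivative d) (at \<tau>)"
  shows "D_tau f \<tau> S = d"
proof -
  have "((\<lambda>t. f t S) has_real_derivative d) (at \<tau>)"
    by (rule has_field_derivative_transform_within_open[OF assms(3), of "{0<..}"])
       (use assms(1,2) in auto)
  then show ?thesis
    unfolding D_tau_def by (rule DERIV_imp_deriv)
qed

lemma D_S_eqI:
  assumes "\<And>s. f \<tau> s = g s" and "(g has_real_derivative d) (at S)"
  shows "D_S f \<tau> S = d"
  using assms by (simp add: D_S_def DERIV_imp_deriv)

lemma D_S_ebar:
  assumes C: "C > 0" and \<tau>: "\<tau> > 0"
  shows "D_S (ebar C) \<tau> S = exp S / \<tau> + exp (S / C\<^sup>2 - \<tau> / C)"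
  by (rule D_S_eqI[where f = "ebar C", OF ebar_def])
     (use C \<tau> in \<open>auto intro!: derivative_eq_intros simp: field_simps power2_eq_square\<close>)

lemma D_tau_ebar:
  assumes C: "C > 0" and \<tau>: "\<tau> > 0"
  shows "D_tau (ebar C) \<tau> S = - (exp S / \<tau>\<^sup>2) - C * exp (S / C\<^sup>2 - \<tau> / C)"
  by (rule D_tau_eqI[where f = "ebar C" and S = S, OF \<tau> ebar_def])
     (use C \<tau> in \<open>auto intro!: derivative_eq_intros simp: field_simps power2_eq_square\<close>)

lemma D_S_D_tau_ebar:
  assumes C: "C > 0" and \<tau>: "\<tau> > 0"
  shows "D_S (D_tau (ebar C)) \<tau> S = - (exp S / \<tau>\<^sup>2) - exp (S / C\<^sup>2 - \<tau> / C) / C"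
  by (rule D_S_eqI[where f = "D_tau (ebar C)", OF D_tau_ebar[OF C \<tau>]])
     (use C \<tau> in \<open>auto intro!: derivative_eq_intros simp: field_simps power2_eq_square\<close>)

lemma D_tau_D_tau_ebar:
  assumes C: "C > 0" and \<tau>: "\<tau> > 0"
  shows "D_tau (D_tau (ebar C)) \<tau> S = 2 * exp S / \<tau>^3 + exp (S / C\<^sup>2 - \<tau> / C)"
  by (rule D_tau_eqI[where f = "D_tau (ebar C)" and S = S, OF \<tau> D_tau_ebar[OF C]])
     (use C \<tau> in \<open>auto intro!: derivative_eq_intros simp: field_simps eval_nat_numeral\<close>)

lemma D_tau_D_tau_D_tau_ebar:
  assumes C: "C > 0" and \<tau>: "\<tau> > 0"
  shows "D_tau (D_tau (D_tau (ebar C))) \<tau> S = - (6 * exp S / \<tau>^4) - exp (S / C\<^sup>2 - \<tau> / C) / C"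
  by (rule D_tau_eqI[where f = "D_tau (D_tau (ebar C))" and S = S, OF \<tau> D_tau_D_tau_ebar[OF C]])
     (use C \<tau> in \<open>auto intro!: derivative_eq_intros simp: field_simps eval_nat_numeral\<close>)

text \<open>For fixed \<open>\<tau>\<close>, both \<open>ebar\<close> and \<open>- ebar_\<tau>\<close> have the form treated in the next two lemmas.\<close>

lemma tendsto_0_exp_combination:
  fixes A B k c :: real
  assumes "k > 0"
  shows "((\<lambda>S. A * exp S + B * exp (S / k - c)) \<longlongrightarrow> 0) at_bot"
proof -
  have "filterlim (\<lambda>S. (1 / k) * S) at_bot at_bot"
    by (rule filterlim_tendsto_pos_mult_at_bot[OF tendsto_const _ filterlim_ident])
       (use assms in simp)
  then have "((\<lambda>S. exp ((1 / k) * S)) \<longlongrightarrow> 0) at_bot"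
    by (rule filterlim_compose[OF exp_at_bot])
  then have "((\<lambda>S. A * exp S + B * (exp ((1 / k) * S) / exp c)) \<longlongrightarrow> A * 0 + B * (0 / exp c)) at_bot"
    by (intro tendsto_intros exp_at_bot) auto
  then show ?thesis by (simp add: exp_diff)
qed

lemma filterlim_at_top_exp_combination:
  fixes A B k c :: real
  assumes "A > 0" and "B \<ge> 0"
  shows "filterlim (\<lambda>S. A * exp S + B * exp (S / k - c)) at_top at_top"
proof (rule filterlim_at_top_mono)
  show "filterlim (\<lambda>S. A * exp S) at_top at_top"
    by (rule filterlim_tendsto_pos_mult_at_top[OF tendsto_const \<open>A > 0\<close> exp_at_top])
qed (use assms in auto)

text \<open>The value of \<open>S\<close> solves \<open>S = S / C\<^sup>2 - 1 / C\<close>, so that at \<open>\<tau> = 1\<close> the two exponentials in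
  \<open>ebar\<close> are equal. By homogeneity, their common value then drops out of the inequality.\<close>

lemma ebar_violation:
  assumes C: "C \<ge> 10"
  defines "S \<equiv> - C / (C\<^sup>2 - 1)"
  shows "\<not> (- (D_S (D_tau (ebar C)) 1 S / (D_S (ebar C) 1 S * D_tau (D_tau (ebar C)) 1 S))
              < - (2 / D_tau (ebar C) 1 S))"
proof -
  define a where "a = exp S"
  have a: "a > 0" by (simp add: a_def)
  have "C\<^sup>2 > 1"
    using C by (simp add: one_less_power)
  then have "S / C\<^sup>2 - 1 / C = S"
    using C by (simp add: S_def field_simps power2_eq_square)
  then have "exp (S / C\<^sup>2 - 1 / C) = a"
    by (simp add: a_def)
  then have D: "D_S (D_tau (ebar C)) 1 S = - a - a / C" "D_S (ebar C) 1 S = 2 * a"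
      "D_tau (D_tau (ebar C)) 1 S = 3 * a" "D_tau (ebar C) 1 S = - a - C * a"
    using C by (simp_all add: D_S_D_tau_ebar D_S_ebar D_tau_D_tau_ebar D_tau_ebar flip: a_def)
  have lhs: "- ((- a - a / C) / (2 * a * (3 * a))) = (1 + 1 / C) / (6 * a)"
    using a C by (simp add: field_simps)
  have "- a - C * a = - ((1 + C) * a)"
    by (simp add: algebra_simps)
  then have rhs: "- (2 / (- a - C * a)) = 2 / ((1 + C) * a)"
    by simp
  have "(1 + 1 / C) * (1 + C) = 2 + C + 1 / C"
    using C by (simp add: field_simps)
  moreover have "1 / C > 0"
    using C by simp
  ultimately have "12 \<le> (1 + 1 / C) * (1 + C)"
    using C by linarith
  then have "2 / (1 + C) \<le> (1 + 1 / C) / 6"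
    using C by (simp add: pos_divide_le_eq)
  then have "2 / (1 + C) / a \<le> (1 + 1 / C) / 6 / a"
    using a by (intro divide_right_mono) auto
  then show ?thesis
    unfolding D lhs rhs by simp
qed

theorem theorem1p2:
  shows "\<forall>\<^sub>F C :: real in at_top.
    (\<forall>\<tau> S. \<tau> > 0 \<longrightarrow>
        ebar C \<tau> S > 0
      \<and> - D_tau (ebar C) \<tau> S > 0
      \<and> D_S (ebar C) \<tau> S > 0
      \<and> - D_tau (D_tau (ebar C)) \<tau> S < 0
      \<and> - D_tau (D_tau (D_tau (ebar C))) \<tau> S > 0
      \<and> - D_S (D_tau (ebar C)) \<tau> S > 0)
  \<and> (\<forall>\<tau> > 0.
        ((\<lambda>S. ebar C \<tau> S) \<longlongrightarrow> 0) at_bot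
      \<and> filterlim (\<lambda>S. ebar C \<tau> S) at_top at_top
      \<and> ((\<lambda>S. - D_tau (ebar C) \<tau> S) \<longlongrightarrow> 0) at_bot
      \<and> filterlim (\<lambda>S. - D_tau (ebar C) \<tau> S) at_top at_top)
  \<and> (\<exists>\<tau> S. \<tau> > 0 \<and>
        \<not> (- (D_S (D_tau (ebar C)) \<tau> S / (D_S (ebar C) \<tau> S * D_tau (D_tau (ebar C)) \<tau> S))
            < - (2 / D_tau (ebar C) \<tau> S)))"
proof (rule eventually_mono[OF eventually_ge_at_top[of 10]], intro conjI allI impI)
  fix C \<tau> S :: real
  assume "10 \<le> C" and \<tau>: "\<tau> > 0"
  then have C: "C > 0" by simp
  note D = D_S_ebar[OF C \<tau>] D_tau_ebar[OF C \<tau>] D_S_D_tau_ebar[OF C \<tau>]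
    D_tau_D_tau_ebar[OF C \<tau>] D_tau_D_tau_D_tau_ebar[OF C \<tau>]
  have "D_tau (D_tau (ebar C)) \<tau> S > 0"
    unfolding D by (rule add_pos_pos) (use \<tau> in simp_all)
  then show "- D_tau (D_tau (ebar C)) \<tau> S < 0" by simp
  show "ebar C \<tau> S > 0" "- D_tau (ebar C) \<tau> S > 0" "D_S (ebar C) \<tau> S > 0"
    "- D_tau (D_tau (D_tau (ebar C))) \<tau> S > 0"
    "- D_S (D_tau (ebar C)) \<tau> S > 0"
    using C \<tau> by (simp_all add: D ebar_def add_pos_pos)
next
  fix C \<tau> :: real
  assume "10 \<le> C" and \<tau>: "\<tau> > 0"
  then have C: "C > 0" by simp
  have e: "ebar C \<tau> = (\<lambda>S. (1 / \<tau>) * exp S + C\<^sup>2 * exp (S / C\<^sup>2 - \<tau> / C))"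
    by (simp add: ebar_def fun_eq_iff)
  have p: "(\<lambda>S. - D_tau (ebar C) \<tau> S) = (\<lambda>S. (1 / \<tau>\<^sup>2) * exp S + C * exp (S / C\<^sup>2 - \<tau> / C))"
    by (simp add: D_tau_ebar[OF C \<tau>] add.commute)
  show "((\<lambda>S. ebar C \<tau> S) \<longlongrightarrow> 0) at_bot" "((\<lambda>S. - D_tau (ebar C) \<tau> S) \<longlongrightarrow> 0) at_bot"
    unfolding e p by (rule tendsto_0_exp_combination, use C in simp)+
  show "filterlim (\<lambda>S. ebar C \<tau> S) at_top at_top"
    "filterlim (\<lambda>S. - D_tau (ebar C) \<tau> S) at_top at_top"
    unfolding e p by (rule filterlim_at_top_exp_combination; use C \<tau> in simp)+
next
  fix C :: real
  assume "10 \<le> C"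
  then show "\<exists>\<tau> S. \<tau> > 0 \<and>
        \<not> (- (D_S (D_tau (ebar C)) \<tau> S / (D_S (ebar C) \<tau> S * D_tau (D_tau (ebar C)) \<tau> S))
            < - (2 / D_tau (ebar C) \<tau> S))"
    using ebar_violation zero_less_one by blast
qed

end
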